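(* Let $(K,d,m)$ be a measure metric group admitting a martingale chain with length $\ell$ and scale $\varrho$. Then $\mathbf{w}_d(\Phi)\le2\ell\,\mathbf{v}_m(\Phi,\varrho)$ for every $\mathcal{D}(K,m)$-valued measurable kernel $\Phi$; that is, $$\Omega_{(K,d,m)}(\varrho,\epsilon)\le2\ell\epsilon,\qquad\epsilon>0.$$
   Context: A measure metric group $(K,d,m)$ consists of a compact metrizable group $K$, a compatible right-invariant metric $d$ on $K$ (so $d(xg,yg)=d(x,y)$), and the Haar probability measure $m$ of $K$. Write $e_K$ for the identity. **Martingale chains.** A martingale chain in $(K,d,m)$ is a finite sequence $\{e_K\}=H_0\le H_1\le\cdots\le H_N=K$ of compact subgroups. Its quotient radii are $\rho_i:=\sup_{g\in H_i}\inf_{h\in H_{i-1}}d(e_K,gh)$, $1\le i\le N$; its length is $\ell:=\sum_{i=1}^N\rho_i$ and its scale is $\varrho:=\max_{1\le i\le N}\rho_i$. **Wasserstein modulus.** Put $B_d(r):=\{h\in K: d(e_K,h)\le r\}$. Let $\mathcal{D}(K,m):=\{\phi\in L^1(K,m):\phi\ge 0,\ \int_K\phi\,dm=1\}$; for $\phi\in\mathcal{D}(K,m)$ let $\phi m$ be the probability measure with density $\phi$ with respect to $m$, and for $h\in K$ put $(h.\phi)(g):=\phi(h^{-1}g)$. Put $\mathbf{V}_m(\phi,\phi'):=\frac12\int_K|\phi-\phi'|\,dm$, and for Borel probability measures $\alpha,\beta$ on $K$ put $\mathbf{W}_d(\alpha,\beta):=\sup_f\left|\int f\,d\alpha-\int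 f\,d\beta\right|$, the supremum over all real functions $f$ on $K$ that are $1$-Lipschitz with respect to $d$. A $\mathcal{D}(K,m)$-valued measurable kernel is a family $\Phi=\{\phi_z:z\in Z\}\subset\mathcal{D}(K,m)$ indexed by a probability space $(Z,\zeta)$ and measurable (i.e. $(z,g)\mapsto\phi_z(g)$ is measurable). For $r\ge0$ put $$\mathbf{v}_m(\Phi,r):=\sup_{h\in B_d(r)}\int_Z\mathbf{V}_m(h.\phi_z,\phi_z)\,d\zeta(z),\qquad \mathbf{w}_d(\Phi):=\int_Z\mathbf{W}_d(\phi_z m,m)\,d\zeta(z),$$ and, for $\epsilon>0$, $\Omega_{(K,d,m)}(r,\epsilon):=\sup\{\mathbf{w}_d(\Phi):\mathbf{v}_m(\Phi,r)\le\epsilon\}$, the supremum over all $\mathcal{D}(K,m)$-valued measurable kernels $\Phi$ (over all probability spaces). *)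

theory Defs
  imports "HOL-Probability.Probability"
begin

text \<open>
  The group is the whole type, an instance of the library's class of topological groups. That class
  is written additively but is not assumed commutative: \<open>x + y\<close> is the product \<open>xy\<close>, \<open>- x\<close> the
  inverse and \<open>0\<close> the identity. The compatible metric is \<open>dist\<close>, since \<open>metric_space\<close> ties it to
  the topology that makes the group operations continuous.
\<close>

text \<open>
  Only left invariance is required of \<open>m\<close>: on a compact group this already characterises the Haar
  probability measure and implies right invariance.
\<close>

definition haar_probability :: "'a::{metric_space,topological_group_add} measure \<Rightarrow> bool" where
  "haar_probability m \<longleftrightarrow>
     prob_space m \<and> sets m = sets borel \<and> (\<forall>g. distr m m (\<lambda>x. g + x) = m)"

definition measure_metric_group :: "'a::{metric_space,topological_group_add} measure \<Rightarrow> bool" where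
  "measure_metric_group m \<longleftrightarrow>
     compact (UNIV :: 'a set) \<and>
     (\<forall>x y g :: 'a. dist (x + g) (y + g) = dist x y) \<and>
     haar_probability m"

definition compact_subgroup :: "'a::{metric_space,topological_group_add} set \<Rightarrow> bool" where
  "compact_subgroup H \<longleftrightarrow>
     compact H \<and> 0 \<in> H \<and> (\<forall>x\<in>H. \<forall>y\<in>H. x + y \<in> H) \<and> (\<forall>x\<in>H. - x \<in> H)"

definition martingale_chain ::
    "nat \<Rightarrow> (nat \<Rightarrow> 'a::{metric_space,topological_group_add} set) \<Rightarrow> bool" where
  "martingale_chain N H \<longleftrightarrow>
     (\<forall>i\<le>N. compact_subgroup (H i)) \<and> H 0 = {0} \<and> H N = UNIV \<and> (\<forall>i<N. H i \<subseteq> H (Suc i))"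

text \<open>Used for \<open>1 \<le> i \<le> N\<close>; compactness makes the real infima and suprema those of bounded sets.\<close>

definition quotient_radius ::
    "(nat \<Rightarrow> 'a::{metric_space,topological_group_add} set) \<Rightarrow> nat \<Rightarrow> real" where
  "quotient_radius H i = (SUP g\<in>H i. INF h\<in>H (i - 1). dist 0 (g + h))"

definition chain_length ::
    "nat \<Rightarrow> (nat \<Rightarrow> 'a::{metric_space,topological_group_add} set) \<Rightarrow> real" where
  "chain_length N H = (\<Sum>i=1..N. quotient_radius H i)"

text \<open>
  Quotient radii are nonnegative, so the inserted \<open>0\<close> matters only when \<open>N = 0\<close> (the trivial group),
  where the maximum of no radii is read as \<open>0\<close>.
\<close>

definition chain_scale ::
    "nat \<Rightarrow> (nat \<Rightarrow> 'a::{metric_space,topological_group_add} set) \<Rightarrow> real" where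
  "chain_scale N H = Max (insert 0 (quotient_radius H ` {1..N}))"

text \<open>Probability densities are handled through representatives, so nonnegativity holds a.e.\<close>

definition prob_densities :: "'a measure \<Rightarrow> ('a \<Rightarrow> real) set" where
  "prob_densities m = {\<phi>. integrable m \<phi> \<and> (AE g in m. 0 \<le> \<phi> g) \<and> (\<integral>g. \<phi> g \<partial>m) = 1}"

definition density_measure :: "'a measure \<Rightarrow> ('a \<Rightarrow> real) \<Rightarrow> 'a measure" where
  "density_measure m \<phi> = density m (\<lambda>g. ennreal (\<phi> g))"

definition left_translate :: "'a::group_add \<Rightarrow> ('a \<Rightarrow> real) \<Rightarrow> 'a \<Rightarrow> real" where
  "left_translate h \<phi> = (\<lambda>g. \<phi> (- h + g))"

text \<open>
  The quantities below take values in \<open>ennreal\<close>, so that all suprema and integrals are total; on the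
  objects considered they are finite.
\<close>

definition total_variation :: "'a measure \<Rightarrow> ('a \<Rightarrow> real) \<Rightarrow> ('a \<Rightarrow> real) \<Rightarrow> ennreal" where
  "total_variation m \<phi> \<phi>' = (\<integral>\<^sup>+g. ennreal \<bar>\<phi> g - \<phi>' g\<bar> \<partial>m) / 2"

definition wasserstein :: "'a::metric_space measure \<Rightarrow> 'a measure \<Rightarrow> ennreal" where
  "wasserstein \<alpha> \<beta> =
     (SUP f\<in>{f :: 'a \<Rightarrow> real. 1-lipschitz_on UNIV f}.
        ennreal \<bar>(\<integral>x. f x \<partial>\<alpha>) - (\<integral>x. f x \<partial>\<beta>)\<bar>)"

definition density_kernel :: "'a measure \<Rightarrow> 'z measure \<Rightarrow> ('z \<Rightarrow> 'a \<Rightarrow> real) \<Rightarrow> bool" where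
  "density_kernel m Z \<Phi> \<longleftrightarrow>
     prob_space Z \<and> (\<forall>z\<in>space Z. \<Phi> z \<in> prob_densities m) \<and>
     (\<lambda>(z, g). \<Phi> z g) \<in> borel_measurable (Z \<Otimes>\<^sub>M m)"

definition kernel_variation ::
    "'a::{metric_space,topological_group_add} measure \<Rightarrow> 'z measure \<Rightarrow> ('z \<Rightarrow> 'a \<Rightarrow> real) \<Rightarrow> real
      \<Rightarrow> ennreal" where
  "kernel_variation m Z \<Phi> r =
     (SUP h\<in>{h. dist 0 h \<le> r}. \<integral>\<^sup>+z. total_variation m (left_translate h (\<Phi> z)) (\<Phi> z) \<partial>Z)"

definition kernel_wasserstein ::
    "'a::metric_space measure \<Rightarrow> 'z measure \<Rightarrow> ('z \<Rightarrow> 'a \<Rightarrow> real) \<Rightarrow> ennreal" where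
  "kernel_wasserstein m Z \<Phi> = (\<integral>\<^sup>+z. wasserstein (density_measure m (\<Phi> z)) m \<partial>Z)"

text \<open>
  A supremum over all probability spaces cannot range over all types inside one term, so the type
  carrying them is an argument; statements about it are to be read for every type \<open>'z\<close>.
\<close>

definition wasserstein_modulus ::
    "'z itself \<Rightarrow> 'a::{metric_space,topological_group_add} measure \<Rightarrow> real \<Rightarrow> real \<Rightarrow> ennreal" where
  "wasserstein_modulus T m r \<epsilon> =
     (SUP (Z, \<Phi>)\<in>{(Z :: 'z measure, \<Phi>). density_kernel m Z \<Phi> \<and> kernel_variation m Z \<Phi> r \<le> ennreal \<epsilon>}.
        kernel_wasserstein m Z \<Phi>)"

end

theory Submission
  imports Defs
begin

text \<open>
  Let \<open>A\<^sub>i f\<close> be the average of a 1-Lipschitz \<open>f\<close> over the orbits of the left action of \<open>H\<^sub>i\<close>.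
  Since \<open>A\<^sub>0 f = f\<close> and \<open>A\<^sub>N f\<close> is the constant \<open>\<integral>f dm\<close>, the number \<open>\<integral>f\<phi> dm - \<integral>f dm\<close> is the sum of the
  integrals of \<open>D\<^sub>i = A\<^sub>i\<^sub>-\<^sub>1 f - A\<^sub>i f\<close> against \<open>\<phi>\<close>. Representing cosets of \<open>H\<^sub>i\<^sub>-\<^sub>1\<close> in \<open>H\<^sub>i\<close> by elements \<open>c\<close>
  at distance at most \<open>\<rho>\<^sub>i\<close> from the identity shows both that \<open>\<bar>D\<^sub>i\<bar> \<le> \<rho>\<^sub>i\<close> and that the translates
  \<open>D\<^sub>i(c \<sqdot>)\<close> average to zero over \<open>c\<close>. Hence the integral of \<open>D\<^sub>i \<phi>\<close> is the average over \<open>c\<close> of the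
  integrals of \<open>D\<^sub>i (\<phi> - c.\<phi>)\<close>, each of which is at most \<open>2\<rho>\<^sub>i\<close> times the variation of \<open>\<phi>\<close> under \<open>c\<close>.
  The elements \<open>c\<close> and their weights depend neither on \<open>f\<close> nor on \<open>\<phi>\<close>, so the estimate can be
  integrated over the kernel. To avoid Haar measures on the subgroups and measurable selection of
  the \<open>c\<close>, the averages are taken over finitely supported distributions on \<open>H\<^sub>i\<close> that are invariant
  up to a small error, uniformly over the relevant \<open>f\<close>.
\<close>

section \<open>Averages over finitely supported distributions\<close>

text \<open>As a plain finite sum it is linear and can be interchanged with other such averages by
  algebra alone. On an infinite support it takes the default value 0.\<close>

definition mean :: "'a pmf \<Rightarrow> ('a \<Rightarrow> real) \<Rightarrow> real" where
  "mean p f = (\<Sum>x\<in>set_pmf p. pmf p x * f x)"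

lemma mean_eq_expectation:
  assumes "finite (set_pmf p)"
  shows "mean p f = measure_pmf.expectation p f"
  unfolding mean_def using assms
  by (subst integral_measure_pmf[where A = "set_pmf p"]) auto

lemma mean_const: "finite (set_pmf p) \<Longrightarrow> mean p (\<lambda>_. c) = c"
  by (simp add: mean_eq_expectation)

lemma mean_diff: "mean p (\<lambda>x. f x - g x) = mean p f - mean p g"
  by (simp add: mean_def algebra_simps sum_subtractf)

lemma mean_mono: "(\<And>x. x \<in> set_pmf p \<Longrightarrow> f x \<le> g x) \<Longrightarrow> mean p f \<le> mean p g"
  by (simp add: mean_def sum_mono mult_left_mono)

lemma abs_mean_le: "\<bar>mean p f\<bar> \<le> mean p (\<lambda>x. \<bar>f x\<bar>)"
  unfolding mean_def by (rule order.trans[OF sum_abs]) (simp add: abs_mult)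

lemma mean_dist_le:
  assumes "finite (set_pmf p)" "\<And>x. x \<in> set_pmf p \<Longrightarrow> \<bar>f x - g x\<bar> \<le> c"
  shows "\<bar>mean p f - mean p g\<bar> \<le> c"
proof -
  have "\<bar>mean p f - mean p g\<bar> \<le> mean p (\<lambda>x. \<bar>f x - g x\<bar>)"
    using abs_mean_le[of p "\<lambda>x. f x - g x"] by (simp add: mean_diff)
  also have "\<dots> \<le> mean p (\<lambda>_. c)" by (rule mean_mono) (rule assms(2))
  finally show ?thesis using assms(1) by (simp add: mean_const)
qed

lemma mean_swap: "mean p (\<lambda>x. mean q (\<lambda>y. f x y)) = mean q (\<lambda>y. mean p (\<lambda>x. f x y))"
  unfolding mean_def sum_distrib_left
  by (subst sum.swap) (simp add: mult.left_commute)

lemma mean_map: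
  assumes "finite (set_pmf p)"
  shows "mean (map_pmf s p) f = mean p (\<lambda>x. f (s x))"
  using assms by (simp add: mean_eq_expectation)

lemma mean_pair:
  assumes "finite (set_pmf p)" "finite (set_pmf q)"
  shows "mean (pair_pmf p q) f = mean p (\<lambda>x. mean q (\<lambda>y. f (x, y)))"
  unfolding mean_def
  by (simp add: sum.cartesian_product' sum_distrib_left pmf_pair mult.assoc)

text \<open>Turns the masses collected at the points of a finite net into a distribution. Weights
  may vanish, so the support is only contained in \<open>k\<close>.\<close>

lemma ex_pmf_weights:
  fixes w :: "'a \<Rightarrow> real"
  assumes "finite k" "\<And>x. x \<in> k \<Longrightarrow> 0 \<le> w x" "(\<Sum>x\<in>k. w x) = 1"
  obtains p where "set_pmf p \<subseteq> k" "\<And>f. mean p f = (\<Sum>x\<in>k. w x * f x)"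
proof -
  define v where "v = (\<lambda>x. if x \<in> k then w x else 0)"
  have v0: "0 \<le> v x" for x using assms(2) by (simp add: v_def)
  have "(\<integral>\<^sup>+ x. ennreal (v x) \<partial>count_space UNIV) = (\<Sum>x\<in>k. ennreal (v x))"
    using assms(1) by (intro nn_integral_count_space') (auto simp: v_def)
  also have "\<dots> = ennreal (\<Sum>x\<in>k. v x)" using v0 by simp
  also have "(\<Sum>x\<in>k. v x) = 1" using assms(3) by (simp add: v_def)
  finally have "(\<integral>\<^sup>+ x. ennreal (v x) \<partial>count_space UNIV) = 1" by simp
  note P = pmf_embed_pmf[OF v0 this]
  define p where "p = embed_pmf v"
  have pv: "pmf p x = v x" for x using P by (simp add: p_def)
  show thesis
  proof
    show sub: "set_pmf p \<subseteq> k" by (auto simp: set_pmf_eq pv v_def)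
    show "mean p f = (\<Sum>x\<in>k. w x * f x)" for f
      unfolding mean_def
      by (rule sum.mono_neutral_cong_left) (use assms(1) sub in \<open>auto simp: pv v_def set_pmf_eq\<close>)
  qed
qed

section \<open>Bi-invariant closeness and almost invariant distributions\<close>

text \<open>
  Quantifying over left translates makes this closeness invariant under both translations and
  inversion when \<open>dist\<close> is right invariant; it is the bi-invariant metric \<open>sup\<^sub>a d(ax,ay)\<close>
  without the supremum.
\<close>

definition near :: "real \<Rightarrow> 'a::{metric_space,topological_group_add} \<Rightarrow> 'a \<Rightarrow> bool" where
  "near \<delta> x y \<longleftrightarrow> (\<forall>a. dist (a + x) (a + y) \<le> \<delta>)"

text \<open>These are the 1-Lipschitz functions for the bi-invariant metric. They include all
  functions 1-Lipschitz for \<open>dist\<close>, and unlike those they are stable under left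
  translation and inversion.\<close>

definition near_lipschitz :: "('a::{metric_space,topological_group_add} \<Rightarrow> real) \<Rightarrow> bool" where
  "near_lipschitz f \<longleftrightarrow> (\<forall>\<delta> x y. near \<delta> x y \<longrightarrow> \<bar>f x - f y\<bar> \<le> \<delta>)"

text \<open>A single \<open>p\<close> has to serve all test functions at once: the weights it
  supplies must not depend on the function tested in the Wasserstein distance.\<close>

definition approx_haar ::
    "'a::{metric_space,topological_group_add} set \<Rightarrow> real \<Rightarrow> 'a pmf \<Rightarrow> bool" where
  "approx_haar H \<epsilon> p \<longleftrightarrow> finite (set_pmf p) \<and> set_pmf p \<subseteq> H \<and>
     (\<forall>f. near_lipschitz f \<longrightarrow> (\<forall>h\<in>H.
        \<bar>mean p (\<lambda>x. f (h + x)) - mean p f\<bar> \<le> \<epsilon> \<and> \<bar>mean p (\<lambda>x. f (x + h)) - mean p f\<bar> \<le> \<epsilon>))"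

lemma approx_haarD:
  assumes "approx_haar H \<epsilon> p"
  shows "finite (set_pmf p)" "x \<in> set_pmf p \<Longrightarrow> x \<in> H"
    "near_lipschitz f \<Longrightarrow> h \<in> H \<Longrightarrow> \<bar>mean p (\<lambda>x. f (h + x)) - mean p f\<bar> \<le> \<epsilon>"
    "near_lipschitz f \<Longrightarrow> h \<in> H \<Longrightarrow> \<bar>mean p (\<lambda>x. f (x + h)) - mean p f\<bar> \<le> \<epsilon>"
  using assms by (auto simp: approx_haar_def)

lemma near_sym: "near \<delta> x y \<Longrightarrow> near \<delta> y x"
  by (simp add: near_def dist_commute)

lemma near_trans: "near \<delta> x y \<Longrightarrow> near \<epsilon> y z \<Longrightarrow> near (\<delta> + \<epsilon>) x z"
  unfolding near_def by (meson add_mono dist_triangle order.trans)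

lemma near_add_left: "near \<delta> x y \<Longrightarrow> near \<delta> (b + x) (b + y)"
  unfolding near_def by (metis add.assoc)

lemma near_lipschitzD: "near_lipschitz f \<Longrightarrow> near \<delta> x y \<Longrightarrow> \<bar>f x - f y\<bar> \<le> \<delta>"
  by (simp add: near_lipschitz_def)

lemma near_lipschitz_add_left: "near_lipschitz f \<Longrightarrow> near_lipschitz (\<lambda>x. f (b + x))"
  by (simp add: near_lipschitz_def near_add_left)

lemma lipschitz_imp_near_lipschitz:
  fixes f :: "'a::{metric_space,topological_group_add} \<Rightarrow> real"
  assumes "1-lipschitz_on UNIV f"
  shows "near_lipschitz f"
proof -
  have "\<bar>f x - f y\<bar> \<le> \<delta>" if "near \<delta> x y" for \<delta> x y
    using lipschitz_onD[OF assms, of x y] that[unfolded near_def, rule_format, of 0]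
    by (simp add: dist_real_def)
  then show ?thesis by (simp add: near_lipschitz_def)
qed

section \<open>Compact groups with right-invariant metric and Haar probability\<close>

locale compact_haar_group =
  fixes m :: "'a::{metric_space,topological_group_add} measure"
  assumes mmg: "measure_metric_group m"
begin

lemma compact_UNIV: "compact (UNIV :: 'a set)"
  using mmg by (simp add: measure_metric_group_def)

lemma dist_add_right: "dist (x + g) (y + g) = dist x (y :: 'a)"
  using mmg by (simp add: measure_metric_group_def)

lemma dist_uminus: "dist 0 (- x) = dist 0 (x :: 'a)"
  using dist_add_right[of 0 x "- x"] by (simp add: dist_commute)

sublocale prob_space m
  using mmg by (simp add: measure_metric_group_def haar_probability_def)

lemma sets_m [measurable_cong, simp]: "sets m = sets borel"
  using mmg by (simp add: measure_metric_group_def haar_probability_def)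

lemma space_m [simp]: "space m = UNIV"
  using sets_eq_imp_space_eq[OF sets_m] by simp

lemma prob_UNIV [simp]: "measure m UNIV = 1"
  using prob_space by simp

lemma measurable_add_left: "(\<lambda>x. g + x) \<in> measurable m (m :: 'a measure)"
proof -
  have "continuous_on UNIV (\<lambda>x :: 'a. g + x)" by (intro continuous_intros)
  then have "(\<lambda>x :: 'a. g + x) \<in> borel_measurable borel"
    by (rule borel_measurable_continuous_onI)
  then show ?thesis by (simp cong: measurable_cong_sets)
qed

lemma distr_add_left: "distr m m (\<lambda>x. g + x) = m"
  using mmg by (simp add: measure_metric_group_def haar_probability_def)

lemma integral_add_left:
  assumes "f \<in> borel_measurable borel"
  shows "(\<integral>x. f (g + x) \<partial>m) = (\<integral>x. f x \<partial>m :: real)"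
  using integral_distr[OF measurable_add_left[of g], of f] assms
  by (simp add: distr_add_left cong: measurable_cong_sets)

lemma integrable_add_left:
  assumes "integrable m (f :: 'a \<Rightarrow> real)"
  shows "integrable m (\<lambda>x. f (g + x))"
  using integrable_distr[OF measurable_add_left[of g], of f] assms
  by (simp add: distr_add_left)

lemma near_add_right: "near \<delta> x y \<Longrightarrow> near \<delta> (x + b) (y + (b :: 'a))"
  unfolding near_def by (simp add: add.assoc[symmetric] dist_add_right)

lemma near_uminus:
  assumes "near \<delta> x (y :: 'a)"
  shows "near \<delta> (- x) (- y)"
  unfolding near_def
proof
  fix a
  \<comment> \<open>Right translation by \<open>y\<close> produces \<open>a - x + y\<close> and
    \<open>a\<close>, and \<open>a\<close> equals \<open>a - x + x\<close>: this is closeness of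
    \<open>y\<close> and \<open>x\<close> at the left translate by \<open>a - x\<close>.\<close>
  have "dist (a + - x) (a + - y) = dist (a - x + y) (a - x + x)"
    using dist_add_right[of "a + - x" y "a + - y"] by simp
  also have "\<dots> \<le> \<delta>" using near_sym[OF assms] unfolding near_def by blast
  finally show "dist (a + - x) (a + - y) \<le> \<delta>" .
qed

lemma near_lipschitz_add_right: "near_lipschitz f \<Longrightarrow> near_lipschitz (\<lambda>x. f (x + (b :: 'a)))"
  by (simp add: near_lipschitz_def near_add_right)

lemma near_lipschitz_uminus: "near_lipschitz f \<Longrightarrow> near_lipschitz (\<lambda>x :: 'a. f (- x))"
  by (simp add: near_lipschitz_def near_uminus)

text \<open>The group operation is uniformly continuous on the compact product, and the pairs
  \<open>(a, x)\<close> and \<open>(a, y)\<close> are as far apart as \<open>x\<close> and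
  \<open>y\<close>, whatever \<open>a\<close> is. Hence the bi-invariant metric induces the same
  topology.\<close>

lemma ex_dist_imp_near:
  assumes "0 < \<delta>"
  obtains \<eta> where "0 < \<eta>" "\<And>x y :: 'a. dist x y < \<eta> \<Longrightarrow> near \<delta> x y"
proof -
  have "compact (UNIV \<times> UNIV :: ('a \<times> 'a) set)"
    using compact_UNIV by (intro compact_Times)
  moreover have "continuous_on (UNIV \<times> UNIV) (\<lambda>p :: 'a \<times> 'a. fst p + snd p)"
    by (intro continuous_intros)
  ultimately have "uniformly_continuous_on (UNIV \<times> UNIV) (\<lambda>p :: 'a \<times> 'a. fst p + snd p)"
    by (intro compact_uniformly_continuous)
  then obtain \<eta> where \<eta>: "0 < \<eta>"
    "\<And>p q :: 'a \<times> 'a. dist q p < \<eta> \<Longrightarrow> dist (fst q + snd q) (fst p + snd p) < \<delta>"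
    using assms unfolding uniformly_continuous_on_def by auto
  show thesis
  proof
    show "0 < \<eta>" by (rule \<eta>)
    show "near \<delta> x y" if "dist x y < \<eta>" for x y :: 'a
      unfolding near_def using \<eta>(2)[of "(a, x)" "(a, y)" for a] that
      by (auto simp: dist_Pair_Pair intro: less_imp_le)
  qed
qed

lemma near_lipschitz_continuous:
  assumes "near_lipschitz (f :: 'a \<Rightarrow> real)"
  shows "continuous_on UNIV f"
  unfolding continuous_on_iff
proof (intro ballI allI impI)
  fix x :: 'a and e :: real assume "0 < e"
  then obtain \<eta> where \<eta>: "0 < \<eta>" "\<And>x y :: 'a. dist x y < \<eta> \<Longrightarrow> near (e / 2) x y"
    using ex_dist_imp_near[of "e / 2"] by auto
  then show "\<exists>d>0. \<forall>x'\<in>UNIV. dist x' x < d \<longrightarrow> dist (f x') (f x) < e"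
    using near_lipschitzD[OF assms \<eta>(2)] \<open>0 < e\<close>
    by (intro exI[of _ \<eta>]) (fastforce simp: dist_real_def)
qed

lemma continuous_bounded:
  assumes "continuous_on UNIV (f :: 'a \<Rightarrow> real)"
  obtains B where "\<And>x. \<bar>f x\<bar> \<le> B"
  using compact_imp_bounded[OF compact_continuous_image[OF assms compact_UNIV]]
  by (auto simp: bounded_iff)

lemma integrable_mult_continuous:
  assumes "continuous_on UNIV (f :: 'a \<Rightarrow> real)" "integrable m \<phi>"
  shows "integrable m (\<lambda>x. f x * \<phi> x)"
proof -
  obtain B where "\<And>x. \<bar>f x\<bar> \<le> B" using continuous_bounded[OF assms(1)] by blast
  moreover have "f \<in> borel_measurable m"
    using borel_measurable_continuous_onI[OF assms(1)] by (simp cong: measurable_cong_sets)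
  ultimately show ?thesis
    using assms(2)
    by (intro Bochner_Integration.integrable_bound[OF integrable_mult_right[OF assms(2), of B]])
      (auto simp: abs_mult intro!: mult_right_mono AE_I2 intro: order.trans[OF _ abs_ge_self])
qed

section \<open>Approximate Haar measures of compact subgroups\<close>

text \<open>Finitely many left translates of the ball cover the group and all have its mass, so a
  null ball would contradict total mass 1.\<close>

lemma measure_ball_pos:
  assumes "0 < \<eta>"
  shows "0 < measure m (ball (0 :: 'a) \<eta>)"
proof -
  define V where "V = (\<lambda>x :: 'a. (\<lambda>u. - x + u) -` ball 0 \<eta>)"
  have openV: "open (V x)" for x
    unfolding V_def by (intro open_vimage continuous_intros) simp
  have mV: "measure m (V x) = measure m (ball 0 \<eta>)" for x
    using measure_distr[OF measurable_add_left, of "ball 0 \<eta>" "- x"]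
    by (simp add: distr_add_left V_def)
  have "x \<in> V x" for x using assms by (simp add: V_def)
  then have "UNIV \<subseteq> (\<Union>x\<in>UNIV. V x)" by blast
  then obtain T where T: "finite T" "UNIV \<subseteq> (\<Union>x\<in>T. V x)"
    using compactE_image[OF compact_UNIV, of UNIV V] openV by auto
  have "1 = measure m UNIV" by simp
  also have "\<dots> = measure m (\<Union>x\<in>T. V x)" using T(2) by (metis top.extremum_uniqueI)
  also have "\<dots> \<le> (\<Sum>x\<in>T. measure m (V x))"
    using T(1) openV by (intro finite_measure_subadditive_finite) auto
  finally have "measure m (ball (0 :: 'a) \<eta>) \<noteq> 0" by (auto simp: mV)
  then show ?thesis by (simp add: zero_less_measure_iff)
qed

text \<open>
  The Haar measure of \<open>H\<close> is replaced by \<open>m\<close> restricted to the \<open>H\<close>-invariant neighbourhood \<open>U\<close> of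
  \<open>H\<close>, whose mass is then moved to a finite net of \<open>H\<close>, each \<open>u\<close> being split evenly
  between the net points close to it.
\<close>

lemma ex_left_approx_haar:
  fixes H :: "'a set"
  assumes H: "compact_subgroup H" and "0 < \<epsilon>"
  obtains p where "finite (set_pmf p)" "set_pmf p \<subseteq> H"
    "\<And>f h. near_lipschitz f \<Longrightarrow> h \<in> H \<Longrightarrow> \<bar>mean p (\<lambda>x. f (h + x)) - mean p f\<bar> \<le> \<epsilon>"
proof -
  \<comment> \<open>Moving mass to the net costs \<open>2 * \<delta>\<close> for \<open>f\<close>
    and again \<open>2 * \<delta>\<close> for its translate.\<close>
  define \<delta> where "\<delta> = \<epsilon> / 4"
  have "0 < \<delta>" using assms by (simp add: \<delta>_def)
  then obtain \<eta> where \<eta>: "0 < \<eta>" "\<And>x y :: 'a. dist x y < \<eta> \<Longrightarrow> near \<delta> x y"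
    using ex_dist_imp_near by blast
  obtain k where k: "finite k" "k \<subseteq> H" "H \<subseteq> (\<Union>x\<in>k. ball x \<eta>)"
    using seq_compact_imp_totally_bounded[of H] H \<eta>(1)
    unfolding compact_subgroup_def compact_eq_seq_compact_metric by blast
  \<comment> \<open>\<open>H\<close> itself may be null. The union of the translates
    \<open>h + ball 0 \<eta>\<close> is still invariant under left translation by \<open>H\<close>,
    and it has positive mass.\<close>
  define U where "U = (\<Union>h\<in>H. (\<lambda>u. - h + u) -` ball 0 \<eta>)"
  have openU: "open U"
    unfolding U_def by (intro open_UN ballI open_vimage continuous_intros) simp
  have Uinv: "h + u \<in> U \<longleftrightarrow> u \<in> U" if "h \<in> H" for h u
  proof -
    have *: "h + u \<in> U" if "h \<in> H" "u \<in> U" for h u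
    proof -
      obtain g where g: "g \<in> H" "dist 0 (- g + u) < \<eta>" using \<open>u \<in> U\<close> by (auto simp: U_def)
      have "h + g \<in> H" using H g(1) \<open>h \<in> H\<close> by (auto simp: compact_subgroup_def)
      moreover have "- (h + g) + (h + u) = - g + u"
        by (simp only: minus_add add.assoc minus_add_cancel)
      ultimately show ?thesis using g(2) unfolding U_def by (intro UN_I[of "h + g"]) auto
    qed
    have "- h \<in> H" using H that by (auto simp: compact_subgroup_def)
    then show ?thesis using *[of h u] *[of "- h" "h + u"] that by (auto simp: add.assoc[symmetric])
  qed
  have "ball 0 \<eta> \<subseteq> U" using H by (auto simp: U_def compact_subgroup_def intro!: bexI[of _ 0])
  then have "measure m (ball 0 \<eta>) \<le> measure m U"
    using openU by (intro finite_measure_mono) auto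
  with measure_ball_pos[OF \<eta>(1)] have mU: "0 < measure m U" by linarith
  \<comment> \<open>The radius is \<open>2 * \<delta>\<close> because a point of \<open>U\<close> is
    \<delta>-near some element of \<open>H\<close>, which is \<delta>-near a net point. Closedness
    is wanted for measurability.\<close>
  define C where "C = (\<lambda>x :: 'a. {u. near (2 * \<delta>) x u})"
  have "closed (C x)" for x
  proof -
    have "C x = (\<Inter>a. {u. dist (a + x) (a + u) \<le> 2 * \<delta>})" by (auto simp: C_def near_def)
    moreover have "closed {u. dist (a + x) (a + u) \<le> 2 * \<delta>}" for a
      by (intro closed_Collect_le continuous_intros)
    ultimately show ?thesis by auto
  qed
  then have [measurable]: "C x \<in> sets borel" for x by auto
  have [measurable]: "U \<in> sets borel" using openU by auto
  define n where "n = (\<lambda>u. \<Sum>x\<in>k. indicator (C x) u :: real)"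
  have n1: "1 \<le> n u" if "u \<in> U" for u
  proof -
    obtain h where h: "h \<in> H" "dist 0 (- h + u) < \<eta>" using \<open>u \<in> U\<close> by (auto simp: U_def)
    have "near \<delta> h u" using near_add_left[OF \<eta>(2)[OF h(2)], of h] by (simp add: add.assoc[symmetric])
    moreover obtain x where x: "x \<in> k" "dist x h < \<eta>" using k(3) h(1) by auto
    ultimately have "u \<in> C x" using near_trans[OF \<eta>(2)[OF x(2)], of \<delta> u] by (simp add: C_def)
    then have "1 = (indicator (C x) u :: real)" by simp
    also have "\<dots> \<le> n u" unfolding n_def by (rule member_le_sum) (use x k in auto)
    finally show ?thesis .
  qed
  have [measurable]: "n \<in> borel_measurable borel" unfolding n_def by simp
  \<comment> \<open>The share of \<open>u\<close> sent to \<open>x\<close>. On \<open>U\<close> at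
    least one net point is close, so the denominator is at least 1; off \<open>U\<close> the
    numerator is 0.\<close>
  define q where "q = (\<lambda>x u. indicator U u * indicator (C x) u / n u :: real)"
  have [measurable]: "q x \<in> borel_measurable borel" for x unfolding q_def by simp
  have q0: "0 \<le> q x u" for x u by (auto simp: q_def n_def intro!: divide_nonneg_nonneg sum_nonneg)
  have q1: "q x u \<le> 1" for x u
    using n1[of u] by (auto simp: q_def indicator_def divide_le_eq)
  have qsum: "(\<Sum>x\<in>k. q x u) = indicator U u" for u
    using n1[of u] by (auto simp: q_def n_def sum_divide_distrib[symmetric] indicator_def split: if_splits)
  have qint: "integrable m (q x)" for x
    using q0 q1 by (intro integrable_const_bound[where B = 1]) auto
  define w where "w = (\<lambda>x. (\<integral>u. q x u \<partial>m) / measure m U)"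
  have "(\<Sum>x\<in>k. w x) = (\<integral>u. (\<Sum>x\<in>k. q x u) \<partial>m) / measure m U"
    using qint by (simp add: w_def sum_divide_distrib[symmetric] Bochner_Integration.integral_sum)
  also have "\<dots> = 1" using mU by (simp add: qsum)
  finally have wsum: "(\<Sum>x\<in>k. w x) = 1" .
  have w0: "0 \<le> w x" for x using q0 by (simp add: w_def)
  obtain p where p: "set_pmf p \<subseteq> k" "\<And>f. mean p f = (\<Sum>x\<in>k. w x * f x)"
    using ex_pmf_weights[OF k(1) w0 wsum] by blast
  \<comment> \<open>Normalized integration over \<open>U\<close> is exactly invariant under
    \<open>H\<close>, and \<open>mean p\<close> differs from it by at most
    \<open>2 * \<delta>\<close>, as mass only moves between close points.\<close>
  define I where "I = (\<lambda>f. (\<integral>u. indicator U u * f u \<partial>m) / measure m U)"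
  have close: "\<bar>mean p f - I f\<bar> \<le> 2 * \<delta>" if f: "near_lipschitz f" for f
  proof -
    have cf: "continuous_on UNIV f" by (rule near_lipschitz_continuous[OF f])
    have iq: "integrable m (\<lambda>u. f u * q x u)" for x
      by (rule integrable_mult_continuous[OF cf qint])
    have "mean p f = (\<Sum>x\<in>k. \<integral>u. q x u * f x \<partial>m) / measure m U"
      by (simp add: p(2) w_def sum_divide_distrib)
    moreover have "I f = (\<Sum>x\<in>k. \<integral>u. f u * q x u \<partial>m) / measure m U"
    proof -
      have "indicator U u * f u = (\<Sum>x\<in>k. f u * q x u)" for u
        by (simp add: qsum[symmetric] sum_distrib_left mult.commute)
      then show ?thesis using iq by (simp add: I_def)
    qed
    ultimately have "mean p f - I f
        = (\<Sum>x\<in>k. (\<integral>u. q x u * f x \<partial>m) - (\<integral>u. f u * q x u \<partial>m)) / measure m U"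
      by (simp add: sum_subtractf diff_divide_distrib)
    also have "\<dots> = (\<Sum>x\<in>k. \<integral>u. q x u * (f x - f u) \<partial>m) / measure m U"
      using iq qint by (subst Bochner_Integration.integral_diff[symmetric]) (auto simp: algebra_simps)
    finally have "\<bar>mean p f - I f\<bar> = \<bar>\<Sum>x\<in>k. \<integral>u. q x u * (f x - f u) \<partial>m\<bar> / measure m U"
      by simp
    also have "\<bar>\<Sum>x\<in>k. \<integral>u. q x u * (f x - f u) \<partial>m\<bar> \<le> (\<Sum>x\<in>k. 2 * \<delta> * (\<integral>u. q x u \<partial>m))"
    proof (rule order.trans[OF sum_abs], rule sum_mono)
      fix x assume "x \<in> k"
      have "q x u * \<bar>f x - f u\<bar> \<le> q x u * (2 * \<delta>)" for u
      proof (cases "u \<in> C x")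
        case True
        then show ?thesis using near_lipschitzD[OF f, of "2 * \<delta>" x u] q0
          by (intro mult_left_mono) (auto simp: C_def)
      qed (simp add: q_def)
      moreover have "integrable m (\<lambda>u. q x u * (f x - f u))"
      proof -
        have "integrable m (\<lambda>u. q x u * f x - f u * q x u)"
          using iq qint by (intro Bochner_Integration.integrable_diff integrable_mult_left)
        then show ?thesis by (simp add: algebra_simps)
      qed
      ultimately have "\<bar>\<integral>u. q x u * (f x - f u) \<partial>m\<bar> \<le> (\<integral>u. q x u * (2 * \<delta>) \<partial>m)"
        using qint q0
        by (intro order.trans[OF integral_abs_bound] integral_mono integrable_abs)
          (auto simp: abs_mult)
      then show "\<bar>\<integral>u. q x u * (f x - f u) \<partial>m\<bar> \<le> 2 * \<delta> * (\<integral>u. q x u \<partial>m)"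
        by (simp add: mult.commute)
    qed
    also have "(\<Sum>x\<in>k. 2 * \<delta> * (\<integral>u. q x u \<partial>m)) / measure m U = 2 * \<delta>"
      using wsum by (simp add: w_def sum_distrib_left[symmetric] sum_divide_distrib[symmetric])
    finally show ?thesis using mU by (simp add: divide_right_mono)
  qed
  have Iinv: "I (\<lambda>u. f (h + u)) = I f" if f: "near_lipschitz f" and h: "h \<in> H" for f h
  proof -
    have [measurable]: "f \<in> borel_measurable borel"
      using near_lipschitz_continuous[OF f] by (rule borel_measurable_continuous_onI)
    have "(\<integral>u. indicator U u * f (h + u) \<partial>m) = (\<integral>u. indicator U (h + u) * f (h + u) \<partial>m)"
      by (simp add: indicator_def Uinv[OF h])
    also have "\<dots> = (\<integral>u. indicator U u * f u \<partial>m)"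
      by (rule integral_add_left) measurable
    finally show ?thesis by (simp add: I_def)
  qed
  show thesis
  proof
    show "finite (set_pmf p)" using p(1) k(1) finite_subset by blast
    show "set_pmf p \<subseteq> H" using p(1) k(2) by blast
    show "\<bar>mean p (\<lambda>x. f (h + x)) - mean p f\<bar> \<le> \<epsilon>" if "near_lipschitz f" "h \<in> H" for f h
      using close[OF that(1)] close[OF near_lipschitz_add_left[OF that(1), of h]] Iinv[OF that]
      unfolding \<delta>_def by argo
  qed
qed

text \<open>For independent \<open>x\<close> and \<open>y\<close> drawn from a left almost invariant
  distribution, \<open>x - y\<close> is almost invariant on both sides: a left translation acts on
  \<open>x\<close>, and \<open>x - y + h\<close> is \<open>x - (- h + y)\<close>, so a right
  translation by \<open>h\<close> becomes a left one of \<open>y\<close>.\<close>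

lemma ex_approx_haar:
  fixes H :: "'a set"
  assumes H: "compact_subgroup H" and "0 < \<epsilon>"
  obtains p where "approx_haar H \<epsilon> p"
proof -
  obtain p where p: "finite (set_pmf p)" "set_pmf p \<subseteq> H"
    "\<And>f h. near_lipschitz f \<Longrightarrow> h \<in> H \<Longrightarrow> \<bar>mean p (\<lambda>x. f (h + x)) - mean p f\<bar> \<le> \<epsilon>"
    using ex_left_approx_haar[OF assms] by blast
  define r where "r = map_pmf (\<lambda>(x, y). x - y) (pair_pmf p p)"
  have mr: "mean r f = mean p (\<lambda>x. mean p (\<lambda>y. f (x - y)))" for f
    using p(1) by (simp add: r_def mean_map mean_pair)
  have "approx_haar H \<epsilon> r"
    unfolding approx_haar_def
  proof (intro conjI allI impI ballI)
    show "finite (set_pmf r)" using p(1) by (simp add: r_def)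
    have "x - y \<in> H" if "x \<in> H" "y \<in> H" for x y
      using H that unfolding compact_subgroup_def by (metis diff_conv_add_uminus)
    then show "set_pmf r \<subseteq> H" using p(2) by (auto simp: r_def)
    fix f :: "'a \<Rightarrow> real" and h assume f: "near_lipschitz f" and h: "h \<in> H"
    have "\<bar>mean p (\<lambda>x. f (h + x - y)) - mean p (\<lambda>x. f (x - y))\<bar> \<le> \<epsilon>" for y
      using p(3)[OF near_lipschitz_add_right[OF f, of "- y"] h] by simp
    then show "\<bar>mean r (\<lambda>x. f (h + x)) - mean r f\<bar> \<le> \<epsilon>"
      unfolding mr by (subst (1 2) mean_swap) (rule mean_dist_le[OF p(1)], simp add: add_diff_eq)
    have "- h \<in> H" using H h by (auto simp: compact_subgroup_def)
    then have "\<bar>mean p (\<lambda>y. f (x - y + h)) - mean p (\<lambda>y. f (x - y))\<bar> \<le> \<epsilon>" for x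
      using p(3)[OF near_lipschitz_uminus[OF near_lipschitz_add_left[OF f, of x]], of "- h"]
      by (simp add: minus_add add.assoc[symmetric])
    then show "\<bar>mean r (\<lambda>x. f (x + h)) - mean r f\<bar> \<le> \<epsilon>"
      unfolding mr by (rule mean_dist_le[OF p(1)])
  qed
  then show thesis by (rule that)
qed

section \<open>One step of the chain, tested against a density\<close>

lemma integrable_left_translate:
  assumes "\<phi> \<in> prob_densities m"
  shows "integrable m (\<lambda>g. \<bar>\<phi> (- c + g) - \<phi> g\<bar>)"
  using assms integrable_add_left[of \<phi> "- c"] by (auto simp: prob_densities_def)

lemma integral_left_translate_le:
  assumes "\<phi> \<in> prob_densities m"
  shows "(\<integral>g. \<bar>\<phi> (- c + g) - \<phi> g\<bar> \<partial>m) \<le> 2"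
proof -
  have i: "integrable m \<phi>" "integrable m (\<lambda>g. \<phi> (- c + g))"
    using assms integrable_add_left[of \<phi> "- c"] by (auto simp: prob_densities_def)
  have "(\<integral>g. \<bar>\<phi> (- c + g) - \<phi> g\<bar> \<partial>m) \<le> (\<integral>g. \<bar>\<phi> (- c + g)\<bar> + \<bar>\<phi> g\<bar> \<partial>m)"
    using i by (intro integral_mono) auto
  also have "\<dots> = (\<integral>g. \<bar>\<phi> (- c + g)\<bar> \<partial>m) + (\<integral>g. \<bar>\<phi> g\<bar> \<partial>m)"
    using i by (intro Bochner_Integration.integral_add) auto
  also have "(\<integral>g. \<bar>\<phi> (- c + g)\<bar> \<partial>m) = (\<integral>g. \<bar>\<phi> g\<bar> \<partial>m)"
    using i(1) by (intro integral_add_left)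
      (auto dest!: borel_measurable_integrable simp: measurable_cong_sets[OF sets_m refl])
  also have "(\<integral>g. \<bar>\<phi> g\<bar> \<partial>m) = (\<integral>g. \<phi> g \<partial>m)"
    using assms by (intro integral_cong_AE) (auto simp: prob_densities_def)
  also have "\<dots> = 1" using assms by (simp add: prob_densities_def)
  finally show ?thesis by simp
qed

lemma integral_mult_density_le:
  assumes "\<phi> \<in> prob_densities m" "continuous_on UNIV f" "\<And>x. \<bar>f x\<bar> \<le> e"
  shows "\<bar>\<integral>g. f g * \<phi> g \<partial>m\<bar> \<le> e"
proof -
  have i: "integrable m \<phi>" using assms(1) by (simp add: prob_densities_def)
  have "\<bar>\<integral>g. f g * \<phi> g \<partial>m\<bar> \<le> (\<integral>g. \<bar>f g * \<phi> g\<bar> \<partial>m)" by (rule integral_abs_bound)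
  also have "\<dots> \<le> (\<integral>g. e * \<phi> g \<partial>m)"
  proof (rule integral_mono_AE)
    show "integrable m (\<lambda>g. \<bar>f g * \<phi> g\<bar>)"
      using integrable_mult_continuous[OF assms(2) i] by simp
    show "AE g in m. \<bar>f g * \<phi> g\<bar> \<le> e * \<phi> g"
      using assms(1) unfolding prob_densities_def
      by (auto simp: abs_mult intro!: mult_right_mono assms(3))
  qed (use i in auto)
  also have "\<dots> = e" using assms(1) by (simp add: prob_densities_def)
  finally show ?thesis .
qed

text \<open>
  The points \<open>c y\<close> represent the cosets \<open>y + P\<close>, the points \<open>c' y\<close> the cosets \<open>P + y\<close>.
  Writing the mean over \<open>Q\<close> as a mean over \<open>c y + P\<close> bounds \<open>A - B\<close> by \<open>\<rho>\<close>; writing it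
  as a mean over \<open>P + c' y\<close> shows that \<open>A - B\<close> averages to zero over the translates by the
  \<open>c' y\<close>, and these are then moved onto the density.
\<close>

lemma martingale_step:
  fixes P Q :: "'a set"
  assumes p: "approx_haar P \<epsilon> p" and q: "approx_haar Q \<epsilon> q" and PQ: "P \<subseteq> Q" and "0 \<le> \<epsilon>"
    and c: "\<And>y. y \<in> Q \<Longrightarrow> dist 0 (c y) \<le> \<rho> \<and> - c y + y \<in> P"
    and c': "\<And>y. y \<in> Q \<Longrightarrow> c' y \<in> Q \<and> y - c' y \<in> P"
    and f: "1-lipschitz_on UNIV f" and \<phi>: "\<phi> \<in> prob_densities m"
  defines "A \<equiv> (\<lambda>g. mean p (\<lambda>x. f (x + g)))" and "B \<equiv> (\<lambda>g. mean q (\<lambda>x. f (x + g)))"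
  shows "\<bar>(\<integral>g. A g * \<phi> g \<partial>m) - (\<integral>g. B g * \<phi> g \<partial>m)\<bar>
    \<le> \<rho> * mean q (\<lambda>y. \<integral>g. \<bar>\<phi> (- c' y + g) - \<phi> g\<bar> \<partial>m) + 7 * \<epsilon>"
proof -
  note p' = approx_haarD[OF p] and q' = approx_haarD[OF q]
  have nf: "near_lipschitz f" by (rule lipschitz_imp_near_lipschitz[OF f])
  have nfr: "near_lipschitz (\<lambda>x. f (b + x + g))" for b g
    using near_lipschitz_add_left[OF near_lipschitz_add_right[OF nf, of g], of b] by simp
  have nfr0: "near_lipschitz (\<lambda>x. f (x + g))" for g by (rule near_lipschitz_add_right[OF nf])
  define D where "D = (\<lambda>g. A g - B g)"
  have cA: "continuous_on UNIV A" and cB: "continuous_on UNIV B"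
    unfolding A_def B_def mean_def
    by (intro continuous_intros continuous_on_compose2[OF near_lipschitz_continuous[OF nf]]; simp)+
  then have cD: "continuous_on UNIV D" unfolding D_def by (intro continuous_intros)
  have D_le: "\<bar>D g\<bar> \<le> \<rho> + 2 * \<epsilon>" for g
  proof -
    have 1: "\<bar>mean p (\<lambda>x. mean q (\<lambda>y. f (y + x + g))) - mean p (\<lambda>x. B g)\<bar> \<le> \<epsilon>"
      unfolding B_def
      by (rule mean_dist_le[OF p'(1)]) (rule q'(4)[OF nfr0], use p'(2) PQ in auto)
    \<comment> \<open>Since \<open>y + x\<close> is \<open>c y + ((- c y + y) + x)\<close>, passing
      from \<open>y\<close> to \<open>c y\<close> is a left translation of \<open>x\<close> by an
      element of \<open>P\<close>, which \<open>p\<close> absorbs.\<close>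
    have 2: "\<bar>mean q (\<lambda>y. mean p (\<lambda>x. f (y + x + g))) - mean q (\<lambda>y. mean p (\<lambda>x. f (c y + x + g)))\<bar> \<le> \<epsilon>"
    proof (rule mean_dist_le[OF q'(1)])
      fix y assume "y \<in> set_pmf q"
      then have "- c y + y \<in> P" using c q'(2) by blast
      from p'(3)[OF nfr[of "c y" g] this]
      show "\<bar>mean p (\<lambda>x. f (y + x + g)) - mean p (\<lambda>x. f (c y + x + g))\<bar> \<le> \<epsilon>"
        by (simp add: add.assoc[symmetric])
    qed
    have 3: "\<bar>mean q (\<lambda>y. mean p (\<lambda>x. f (c y + x + g))) - mean q (\<lambda>y. A g)\<bar> \<le> \<rho>"
      unfolding A_def
    proof (rule mean_dist_le[OF q'(1)], rule mean_dist_le[OF p'(1)])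
      fix x y assume "y \<in> set_pmf q"
      \<comment> \<open>By right invariance, left multiplication by \<open>c y\<close> displaces
        every point by exactly \<open>dist 0 (c y)\<close>.\<close>
      have "\<bar>f (c y + x + g) - f (x + g)\<bar> \<le> dist (c y + (x + g)) (0 + (x + g))"
        using lipschitz_onD[OF f, of "c y + x + g" "x + g"] by (simp add: dist_real_def add.assoc)
      also have "\<dots> = dist 0 (c y)" by (simp only: dist_add_right dist_commute)
      also have "\<dots> \<le> \<rho>" using c q'(2) \<open>y \<in> set_pmf q\<close> by blast
      finally show "\<bar>f (c y + x + g) - f (x + g)\<bar> \<le> \<rho>" .
    qed
    show ?thesis
      using 1 2 3 unfolding mean_swap[of p q] mean_const[OF p'(1)] mean_const[OF q'(1)] D_def
      by linarith
  qed
  have D_avg: "\<bar>mean q (\<lambda>y. D (c' y + g))\<bar> \<le> 3 * \<epsilon>" for g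
  proof -
    \<comment> \<open>Here \<open>x + y\<close> is \<open>(x + (y - c' y)) + c' y\<close>, so the
      right almost invariance of \<open>p\<close> under \<open>P\<close> absorbs the
      difference.\<close>
    have 1: "\<bar>mean q (\<lambda>y. mean p (\<lambda>x. f (x + y + g))) - mean q (\<lambda>y. A (c' y + g))\<bar> \<le> \<epsilon>"
      unfolding A_def
    proof (rule mean_dist_le[OF q'(1)])
      fix y assume "y \<in> set_pmf q"
      then have "y - c' y \<in> P" using c' q'(2) by blast
      from p'(4)[OF nfr0[of "c' y + g"] this]
      show "\<bar>mean p (\<lambda>x. f (x + y + g)) - mean p (\<lambda>x. f (x + (c' y + g)))\<bar> \<le> \<epsilon>"
        by (simp add: add.assoc[symmetric] add_diff_eq)
    qed
    have 2: "\<bar>mean p (\<lambda>x. mean q (\<lambda>y. f (x + y + g))) - mean p (\<lambda>x. B g)\<bar> \<le> \<epsilon>"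
      unfolding B_def
      by (rule mean_dist_le[OF p'(1)]) (rule q'(3)[OF nfr0], use p'(2) PQ in auto)
    have 3: "\<bar>mean q (\<lambda>y. B (c' y + g)) - mean q (\<lambda>y. B g)\<bar> \<le> \<epsilon>"
      unfolding B_def
    proof (rule mean_dist_le[OF q'(1)])
      fix y assume "y \<in> set_pmf q"
      then have y: "y \<in> Q" by (rule q'(2))
      have "c' y \<in> Q" using c'[OF y] by blast
      from q'(4)[OF nfr0[of g] this]
      show "\<bar>mean q (\<lambda>x. f (x + (c' y + g))) - mean q (\<lambda>x. f (x + g))\<bar> \<le> \<epsilon>"
        by (simp add: add.assoc)
    qed
    show ?thesis
      using 1 2 3 unfolding mean_swap[of p q] mean_const[OF p'(1)] mean_const[OF q'(1)] D_def mean_diff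
      by linarith
  qed
  have i\<phi>: "integrable m \<phi>" using \<phi> by (simp add: prob_densities_def)
  have i\<phi>': "integrable m (\<lambda>g. \<phi> (- b + g))" for b by (rule integrable_add_left[OF i\<phi>])
  have cD': "continuous_on UNIV (\<lambda>g. D (b + g))" for b
    by (intro continuous_on_compose2[OF cD] continuous_intros) simp
  have shift: "(\<integral>g. D (b + g) * \<phi> g \<partial>m) = (\<integral>g. D g * \<phi> (- b + g) \<partial>m)" for b
  proof -
    have "(\<lambda>g. D g * \<phi> (- b + g)) \<in> borel_measurable m"
      by (rule borel_measurable_integrable[OF integrable_mult_continuous[OF cD i\<phi>']])
    then show ?thesis
      using integral_add_left[of "\<lambda>g. D g * \<phi> (- b + g)" b]
      by (simp add: measurable_cong_sets[OF sets_m refl] add.assoc[symmetric])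
  qed
  have avg: "(\<integral>g. mean q (\<lambda>y. D (c' y + g)) * \<phi> g \<partial>m) = mean q (\<lambda>y. \<integral>g. D g * \<phi> (- c' y + g) \<partial>m)"
  proof -
    have "(\<integral>g. mean q (\<lambda>y. D (c' y + g)) * \<phi> g \<partial>m)
        = (\<integral>g. (\<Sum>y\<in>set_pmf q. pmf q y * (D (c' y + g) * \<phi> g)) \<partial>m)"
      by (simp add: mean_def sum_distrib_right mult.assoc)
    also have "\<dots> = mean q (\<lambda>y. \<integral>g. D (c' y + g) * \<phi> g \<partial>m)"
      unfolding mean_def
      by (subst Bochner_Integration.integral_sum)
        (auto intro!: integrable_mult_right integrable_mult_continuous cD' i\<phi>)
    finally show ?thesis by (simp add: shift)
  qed
  have "\<bar>\<integral>g. mean q (\<lambda>y. D (c' y + g)) * \<phi> g \<partial>m\<bar> \<le> 3 * \<epsilon>"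
    using D_avg by (intro integral_mult_density_le[OF \<phi>])
      (auto simp: mean_def intro!: continuous_intros cD')
  moreover have "\<bar>mean q (\<lambda>y. \<integral>g. D g * \<phi> (- c' y + g) \<partial>m) - mean q (\<lambda>y. \<integral>g. D g * \<phi> g \<partial>m)\<bar>
      \<le> (\<rho> + 2 * \<epsilon>) * mean q (\<lambda>y. \<integral>g. \<bar>\<phi> (- c' y + g) - \<phi> g\<bar> \<partial>m)"
  proof -
    have "\<bar>(\<integral>g. D g * \<phi> (- b + g) \<partial>m) - (\<integral>g. D g * \<phi> g \<partial>m)\<bar>
        \<le> (\<rho> + 2 * \<epsilon>) * (\<integral>g. \<bar>\<phi> (- b + g) - \<phi> g\<bar> \<partial>m)" for b
    proof -
      have i: "integrable m (\<lambda>g. \<phi> (- b + g) - \<phi> g)" using i\<phi> i\<phi>' by simp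
      have "(\<integral>g. D g * \<phi> (- b + g) \<partial>m) - (\<integral>g. D g * \<phi> g \<partial>m)
          = (\<integral>g. D g * (\<phi> (- b + g) - \<phi> g) \<partial>m)"
        using integrable_mult_continuous[OF cD i\<phi>'] integrable_mult_continuous[OF cD i\<phi>]
        by (simp add: right_diff_distrib)
      also have "\<bar>\<dots>\<bar> \<le> (\<integral>g. \<bar>D g * (\<phi> (- b + g) - \<phi> g)\<bar> \<partial>m)" by (rule integral_abs_bound)
      also have "\<dots> \<le> (\<integral>g. (\<rho> + 2 * \<epsilon>) * \<bar>\<phi> (- b + g) - \<phi> g\<bar> \<partial>m)"
        using integrable_mult_continuous[OF cD i] i D_le
        by (intro integral_mono integrable_abs) (auto simp: abs_mult intro!: mult_right_mono)
      finally show ?thesis by simp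
    qed
    then have "mean q (\<lambda>y. \<bar>(\<integral>g. D g * \<phi> (- c' y + g) \<partial>m) - (\<integral>g. D g * \<phi> g \<partial>m)\<bar>)
        \<le> mean q (\<lambda>y. (\<rho> + 2 * \<epsilon>) * (\<integral>g. \<bar>\<phi> (- c' y + g) - \<phi> g\<bar> \<partial>m))"
      by (intro mean_mono)
    also have "\<dots> = (\<rho> + 2 * \<epsilon>) * mean q (\<lambda>y. \<integral>g. \<bar>\<phi> (- c' y + g) - \<phi> g\<bar> \<partial>m)"
      by (simp add: mean_def sum_distrib_left mult.left_commute)
    finally show ?thesis
      unfolding mean_diff[symmetric] by (rule order.trans[OF abs_mean_le])
  qed
  moreover have "2 * \<epsilon> * mean q (\<lambda>y. \<integral>g. \<bar>\<phi> (- c' y + g) - \<phi> g\<bar> \<partial>m) \<le> 2 * \<epsilon> * 2"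
  proof (rule mult_left_mono)
    have "mean q (\<lambda>y. \<integral>g. \<bar>\<phi> (- c' y + g) - \<phi> g\<bar> \<partial>m) \<le> mean q (\<lambda>_. 2)"
      using integral_left_translate_le[OF \<phi>] by (intro mean_mono)
    then show "mean q (\<lambda>y. \<integral>g. \<bar>\<phi> (- c' y + g) - \<phi> g\<bar> \<partial>m) \<le> 2"
      by (simp add: mean_const[OF q'(1)])
  qed (use \<open>0 \<le> \<epsilon>\<close> in simp)
  moreover have "(\<integral>g. D g * \<phi> g \<partial>m) = (\<integral>g. A g * \<phi> g \<partial>m) - (\<integral>g. B g * \<phi> g \<partial>m)"
    using integrable_mult_continuous[OF cA i\<phi>] integrable_mult_continuous[OF cB i\<phi>]
    by (simp add: D_def left_diff_distrib)
  ultimately show ?thesis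
    unfolding avg mean_const[OF q'(1)] distrib_right by linarith
qed

section \<open>Short coset representatives\<close>

text \<open>The infimum over the compact \<open>H (i - 1)\<close> is attained. That the real
  supremum bounds it relies on the family being bounded, which compactness of the group
  provides.\<close>

lemma quotient_radius_attained:
  fixes H :: "nat \<Rightarrow> 'a set"
  assumes H: "martingale_chain N H" and i: "1 \<le> i" "i \<le> N" and y: "y \<in> H i"
  shows "\<exists>h\<in>H (i - 1). dist 0 (y + h) \<le> quotient_radius H i"
proof -
  have "compact (H (i - 1))" "0 \<in> H (i - 1)"
    using H i by (auto simp: martingale_chain_def compact_subgroup_def)
  then obtain h where h: "h \<in> H (i - 1)" "\<forall>h'\<in>H (i - 1). dist 0 (y + h) \<le> dist 0 (y + h')"
    using continuous_attains_inf[of "H (i - 1)" "\<lambda>h. dist 0 (y + h)"]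
      continuous_on_dist[OF continuous_on_const
        continuous_on_add[OF continuous_on_const continuous_on_id], of "H (i - 1)" 0 y]
    by auto
  have "dist 0 (y + h) \<le> (INF h\<in>H (i - 1). dist 0 (y + h))"
    using h by (intro cINF_greatest) auto
  also have "\<dots> \<le> quotient_radius H i"
    unfolding quotient_radius_def
  proof (rule cSUP_upper[OF y])
    obtain B where B: "dist 0 x \<le> B" for x :: 'a
      using compact_imp_bounded[OF compact_UNIV] by (auto simp: bounded_any_center[of _ 0])
    have "(INF h\<in>H (i - 1). dist 0 (g + h)) \<le> B" for g
      using \<open>0 \<in> H (i - 1)\<close> B by (intro cINF_lower2[of _ _ 0]) (blast | auto intro!: bdd_belowI2[of _ 0])+
    then show "bdd_above ((\<lambda>g. INF h\<in>H (i - 1). dist 0 (g + h)) ` H i)"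
      by (intro bdd_aboveI2)
  qed
  finally show ?thesis using h(1) by blast
qed

lemma quotient_radius_nonneg:
  fixes H :: "nat \<Rightarrow> 'a set"
  assumes "martingale_chain N H" "1 \<le> i" "i \<le> N"
  shows "0 \<le> quotient_radius H i"
proof -
  have "0 \<in> H i" using assms by (auto simp: martingale_chain_def compact_subgroup_def)
  from quotient_radius_attained[OF assms this] show ?thesis by (metis order.trans zero_le_dist)
qed

text \<open>Take \<open>c y = y + h\<close> with \<open>h\<close> in \<open>H (i - 1)\<close> as
  short as the quotient radius allows; then \<open>- c y + y\<close> is \<open>- h\<close>.\<close>

lemma ex_coset_representatives:
  fixes H :: "nat \<Rightarrow> 'a set"
  assumes H: "martingale_chain N H" and i: "1 \<le> i" "i \<le> N"
  obtains c where
    "\<And>y. y \<in> H i \<Longrightarrow> c y \<in> H i \<and> dist 0 (c y) \<le> quotient_radius H i \<and> - c y + y \<in> H (i - 1)"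
proof -
  obtain j where "i = Suc j" using i(1) by (cases i) auto
  then have sub: "compact_subgroup (H i)" "compact_subgroup (H (i - 1))" "H (i - 1) \<subseteq> H i"
    using H i(2) by (simp_all add: martingale_chain_def)
  have "\<forall>y\<in>H i. \<exists>c. c \<in> H i \<and> dist 0 c \<le> quotient_radius H i \<and> - c + y \<in> H (i - 1)"
  proof
    fix y assume y: "y \<in> H i"
    obtain h where h: "h \<in> H (i - 1)" "dist 0 (y + h) \<le> quotient_radius H i"
      using quotient_radius_attained[OF H i y] by blast
    have "- (y + h) + y = - h" by (simp only: minus_add add.assoc left_minus add_0_right)
    moreover have "- h \<in> H (i - 1)" "y + h \<in> H i"
      using sub h(1) y by (auto simp: compact_subgroup_def)
    ultimately show "\<exists>c. c \<in> H i \<and> dist 0 c \<le> quotient_radius H i \<and> - c + y \<in> H (i - 1)"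
      using h(2) by (intro exI[of _ "y + h"]) simp
  qed
  from bchoice[OF this] obtain c where
    "\<forall>y\<in>H i. c y \<in> H i \<and> dist 0 (c y) \<le> quotient_radius H i \<and> - c y + y \<in> H (i - 1)" ..
  then show thesis by (intro that[of c]) simp
qed

section \<open>Telescoping along the chain\<close>

text \<open>The order of choice matters: the distributions \<open>p i\<close> and the elements
  \<open>c i y\<close> are fixed before \<open>f\<close> and \<phi>. One finite weighted family of
  translations thus controls all test functions and all densities of a kernel.\<close>

lemma chain_transport:
  fixes H :: "nat \<Rightarrow> 'a set"
  assumes H: "martingale_chain N H" and "0 < \<epsilon>"
  obtains p :: "nat \<Rightarrow> 'a pmf" and c where
    "\<And>i. 1 \<le> i \<Longrightarrow> i \<le> N \<Longrightarrow> finite (set_pmf (p i))"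
    "\<And>i y. 1 \<le> i \<Longrightarrow> i \<le> N \<Longrightarrow> y \<in> set_pmf (p i) \<Longrightarrow> dist 0 (c i y) \<le> quotient_radius H i"
    "\<And>f \<phi>. 1-lipschitz_on UNIV f \<Longrightarrow> \<phi> \<in> prob_densities m \<Longrightarrow>
      \<bar>(\<integral>g. f g * \<phi> g \<partial>m) - (\<integral>g. f g \<partial>m)\<bar>
        \<le> (\<Sum>i=1..N. quotient_radius H i
            * mean (p i) (\<lambda>y. \<integral>g. \<bar>\<phi> (- c i y + g) - \<phi> g\<bar> \<partial>m)) + \<epsilon>"
proof -
  \<comment> \<open>Each of the \<open>N\<close> steps costs \<open>7 * \<delta>\<close>; comparing
    \<open>A N\<close> with a constant costs \<delta> twice, once against \<phi> and once against
    \<open>m\<close>.\<close>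
  define \<delta> where "\<delta> = \<epsilon> / (7 * real N + 2)"
  have \<delta>: "0 < \<delta>" "(7 * real N + 2) * \<delta> = \<epsilon>"
    using \<open>0 < \<epsilon>\<close> by (simp_all add: \<delta>_def add_nonneg_pos add_nonneg_eq_0_iff)
  have sub: "compact_subgroup (H i)" if "i \<le> N" for i
    using H that by (auto simp: martingale_chain_def)
  have "\<forall>i\<in>{..N}. \<exists>p. approx_haar (H i) \<delta> p"
    using ex_approx_haar[OF sub \<open>0 < \<delta>\<close>] by (metis atMost_iff)
  then obtain p where p: "i \<le> N \<Longrightarrow> approx_haar (H i) \<delta> (p i)" for i by (metis atMost_iff)
  have "\<forall>i\<in>{1..N}. \<exists>c. \<forall>y\<in>H i.
      c y \<in> H i \<and> dist 0 (c y) \<le> quotient_radius H i \<and> - c y + y \<in> H (i - 1)"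
    using ex_coset_representatives[OF H] by (metis atLeastAtMost_iff)
  then obtain c where c: "1 \<le> i \<Longrightarrow> i \<le> N \<Longrightarrow> y \<in> H i \<Longrightarrow>
      c i y \<in> H i \<and> dist 0 (c i y) \<le> quotient_radius H i \<and> - c i y + y \<in> H (i - 1)" for i y
    by (metis atLeastAtMost_iff)
  \<comment> \<open>Inversion turns representatives of the cosets \<open>y + H (i - 1)\<close> into
    representatives of the cosets \<open>H (i - 1) + y\<close> and preserves the distance to the
    identity.\<close>
  define c' where "c' = (\<lambda>i y. - c i (- y))"
  have c': "c' i y \<in> H i \<and> dist 0 (c' i y) \<le> quotient_radius H i \<and> y - c' i y \<in> H (i - 1)"
    if "1 \<le> i" "i \<le> N" "y \<in> H i" for i y
  proof -
    have "- y \<in> H i" using sub[of i] that by (auto simp: compact_subgroup_def)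
    note * = c[OF that(1,2) this]
    have "y - c' i y = - (- c i (- y) + - y)" by (simp only: c'_def minus_add minus_minus diff_minus_eq_add)
    moreover have "- (- c i (- y) + - y) \<in> H (i - 1)"
      using * sub[of "i - 1"] that unfolding compact_subgroup_def by (metis diff_le_self order.trans)
    ultimately show ?thesis
      using * sub[of i] that by (auto simp: compact_subgroup_def c'_def dist_uminus)
  qed
  show thesis
  proof (rule that[of p c'])
    show "finite (set_pmf (p i))" if "1 \<le> i" "i \<le> N" for i
      using approx_haarD(1)[OF p[OF that(2)]] .
    show "dist 0 (c' i y) \<le> quotient_radius H i" if "1 \<le> i" "i \<le> N" "y \<in> set_pmf (p i)" for i y
      using c'[OF that(1,2)] approx_haarD(2)[OF p[OF that(2)] that(3)] by blast
    fix f :: "'a \<Rightarrow> real" and \<phi> assume f: "1-lipschitz_on UNIV f" and \<phi>: "\<phi> \<in> prob_densities m"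
    have nf: "near_lipschitz f" by (rule lipschitz_imp_near_lipschitz[OF f])
    define A where "A = (\<lambda>i g. mean (p i) (\<lambda>x. f (x + g)))"
    define R where "R = (\<lambda>i. quotient_radius H i
      * mean (p i) (\<lambda>y. \<integral>g. \<bar>\<phi> (- c' i y + g) - \<phi> g\<bar> \<partial>m))"
    have i\<phi>: "integrable m \<phi>" and \<phi>1: "(\<integral>g. \<phi> g \<partial>m) = 1"
      using \<phi> by (auto simp: prob_densities_def)
    have cA: "continuous_on UNIV (A i)" for i
      unfolding A_def mean_def
      by (intro continuous_intros continuous_on_compose2[OF near_lipschitz_continuous[OF nf]]) simp
    have int_cont: "integrable m h" if "continuous_on UNIV h" for h :: "'a \<Rightarrow> real"
      using integrable_mult_continuous[OF that, of "\<lambda>_. 1"] by simp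
    have step: "\<bar>(\<integral>g. A i g * \<phi> g \<partial>m) - (\<integral>g. A (Suc i) g * \<phi> g \<partial>m)\<bar> \<le> R (Suc i) + 7 * \<delta>"
      if "i < N" for i
      unfolding A_def R_def
    proof (rule martingale_step[OF p p _ _ _ _ f \<phi>])
      show "H i \<subseteq> H (Suc i)" using H that by (auto simp: martingale_chain_def)
      show "dist 0 (c (Suc i) y) \<le> quotient_radius H (Suc i) \<and> - c (Suc i) y + y \<in> H i"
        if "y \<in> H (Suc i)" for y using c[of "Suc i" y] that \<open>i < N\<close> by simp
      show "c' (Suc i) y \<in> H (Suc i) \<and> y - c' (Suc i) y \<in> H i"
        if "y \<in> H (Suc i)" for y using c'[of "Suc i" y] that \<open>i < N\<close> by simp
    qed (use that \<delta>(1) in auto)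
    have tele: "n \<le> N \<Longrightarrow> \<bar>(\<integral>g. A 0 g * \<phi> g \<partial>m) - (\<integral>g. A n g * \<phi> g \<partial>m)\<bar>
        \<le> (\<Sum>i=1..n. R i) + 7 * n * \<delta>" for n
    proof (induction n)
      case (Suc n)
      then show ?case using step[of n] by (simp add: algebra_simps)
    qed simp
    have A0: "A 0 = f"
    proof -
      have "set_pmf (p 0) \<subseteq> {0}" using approx_haarD(2)[OF p[of 0]] H by (auto simp: martingale_chain_def)
      then have "mean (p 0) h = mean (p 0) (\<lambda>_. h 0)" for h
        unfolding mean_def by (intro sum.cong) auto
      then show ?thesis
        using mean_const[OF approx_haarD(1)[OF p[of 0]]] by (simp add: A_def fun_eq_iff)
    qed
    \<comment> \<open>As \<open>H N\<close> is the whole group, every right translation is allowed,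
      so \<open>A N\<close> is constant up to \<delta>.\<close>
    have AN: "\<bar>A N g - A N 0\<bar> \<le> \<delta>" for g
      using approx_haarD(4)[OF p[of N] nf, of g] H by (simp add: A_def martingale_chain_def)
    have cA': "continuous_on UNIV (\<lambda>g. A N g - A N 0)"
      using cA[of N] by (intro continuous_intros)
    have "\<bar>\<integral>g. (A N g - A N 0) * \<phi> g \<partial>m\<bar> \<le> \<delta>"
      by (rule integral_mult_density_le[OF \<phi> cA' AN])
    also have "(\<integral>g. (A N g - A N 0) * \<phi> g \<partial>m) = (\<integral>g. A N g * \<phi> g \<partial>m) - A N 0"
      using integrable_mult_continuous[OF cA i\<phi>] i\<phi> \<phi>1 by (simp add: left_diff_distrib)
    finally have 1: "\<bar>(\<integral>g. A N g * \<phi> g \<partial>m) - A N 0\<bar> \<le> \<delta>" .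
    \<comment> \<open>The same bound for the density 1 compares the constant with the integral of
      \<open>A N\<close>, which left invariance of \<open>m\<close> identifies with that of
      \<open>f\<close>.\<close>
    have "(\<lambda>_. 1) \<in> prob_densities m" by (simp add: prob_densities_def)
    from integral_mult_density_le[OF this cA' AN]
    have "\<bar>\<integral>g. A N g - A N 0 \<partial>m\<bar> \<le> \<delta>" by simp
    also have "(\<integral>g. A N g - A N 0 \<partial>m) = (\<integral>g. A N g \<partial>m) - A N 0"
      using int_cont[OF cA] by simp
    also have "(\<integral>g. A N g \<partial>m) = mean (p N) (\<lambda>x. \<integral>g. f (x + g) \<partial>m)"
      unfolding A_def mean_def
      by (subst Bochner_Integration.integral_sum)
        (auto intro!: integrable_mult_right int_cont continuous_intros
           continuous_on_compose2[OF near_lipschitz_continuous[OF nf]])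
    also have "\<dots> = (\<integral>g. f g \<partial>m)"
      using integral_add_left[OF borel_measurable_continuous_onI[OF near_lipschitz_continuous[OF nf]]]
        mean_const[OF approx_haarD(1)[OF p[of N]]] by simp
    finally have 2: "\<bar>(\<integral>g. f g \<partial>m) - A N 0\<bar> \<le> \<delta>" .
    show "\<bar>(\<integral>g. f g * \<phi> g \<partial>m) - (\<integral>g. f g \<partial>m)\<bar> \<le> (\<Sum>i=1..N. quotient_radius H i
            * mean (p i) (\<lambda>y. \<integral>g. \<bar>\<phi> (- c' i y + g) - \<phi> g\<bar> \<partial>m)) + \<epsilon>"
      using tele[of N] 1 2 \<delta>(2) unfolding A0 R_def distrib_right by simp
  qed
qed

section \<open>Integration over the kernel\<close>

text \<open>The one half in the total variation is the source of the factor 2 in front of the chain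
  length.\<close>

lemma total_variation_eq_integral:
  assumes "\<phi> \<in> prob_densities m"
  shows "ennreal (\<integral>g. \<bar>\<phi> (- c + g) - \<phi> g\<bar> \<partial>m) = 2 * total_variation m (left_translate c \<phi>) \<phi>"
proof -
  have "ennreal (\<integral>g. \<bar>\<phi> (- c + g) - \<phi> g\<bar> \<partial>m) = (\<integral>\<^sup>+g. ennreal \<bar>\<phi> (- c + g) - \<phi> g\<bar> \<partial>m)"
    by (rule nn_integral_eq_integral[symmetric]) (use integrable_left_translate[OF assms] in auto)
  moreover have "2 * (x / 2) = x" for x :: ennreal
    using mult_divide_eq_ennreal[of 2 x] by (simp add: ennreal_times_divide mult.commute)
  ultimately show ?thesis by (simp add: total_variation_def left_translate_def)
qed

lemma integral_density_measure:
  assumes "\<phi> \<in> prob_densities m" "1-lipschitz_on UNIV (f :: 'a \<Rightarrow> real)"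
  shows "(\<integral>g. f g \<partial>density_measure m \<phi>) = (\<integral>g. f g * \<phi> g \<partial>m)"
proof -
  have "f \<in> borel_measurable m"
    using borel_measurable_continuous_onI[OF near_lipschitz_continuous[OF
        lipschitz_imp_near_lipschitz[OF assms(2)]]] by (simp add: measurable_cong_sets[OF sets_m refl])
  then show ?thesis
    using assms(1) unfolding density_measure_def prob_densities_def
    by (subst integral_density) (auto simp: mult.commute)
qed

lemma measurable_total_variation:
  assumes K: "density_kernel m Z \<Phi>"
  shows "(\<lambda>z. total_variation m (left_translate c (\<Phi> z)) (\<Phi> z)) \<in> borel_measurable Z"
proof -
  have [measurable]: "(\<lambda>(z, g). \<Phi> z g) \<in> borel_measurable (Z \<Otimes>\<^sub>M m)"
    using K by (simp add: density_kernel_def)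
  note [measurable] = measurable_add_left[of "- c"]
  have "(\<lambda>(z, g). (z, - c + g)) \<in> measurable (Z \<Otimes>\<^sub>M m) (Z \<Otimes>\<^sub>M m)" by measurable
  from measurable_compose[OF this, of "\<lambda>(z, g). \<Phi> z g"]
  have [measurable]: "(\<lambda>(z, g). \<Phi> z (- c + g)) \<in> borel_measurable (Z \<Otimes>\<^sub>M m)"
    by (simp add: split_beta')
  have "(\<lambda>(z, g). ennreal \<bar>\<Phi> z (- c + g) - \<Phi> z g\<bar>) \<in> borel_measurable (Z \<Otimes>\<^sub>M m)"
    unfolding split_beta' by (intro measurable_compose[OF _ measurable_ennreal] borel_measurable_abs
      borel_measurable_diff) (simp_all add: split_beta'[symmetric])
  then have "(\<lambda>z. \<integral>\<^sup>+g. ennreal \<bar>\<Phi> z (- c + g) - \<Phi> z g\<bar> \<partial>m) \<in> borel_measurable Z"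
    by (rule borel_measurable_nn_integral)
  then show ?thesis unfolding total_variation_def left_translate_def by measurable
qed

text \<open>For fixed \<epsilon>, the transport estimate bounds the Wasserstein distance for every
  \<open>z\<close> by one finite weighted sum of variations. Integrating over \<open>z\<close>
  replaces each of them by at most the kernel variation.\<close>

lemma kernel_wasserstein_le:
  fixes H :: "nat \<Rightarrow> 'a set"
  assumes H: "martingale_chain N H" and K: "density_kernel m Z \<Phi>"
  shows "kernel_wasserstein m Z \<Phi>
    \<le> ennreal (2 * chain_length N H) * kernel_variation m Z \<Phi> (chain_scale N H)"
proof (rule ennreal_le_epsilon)
  define v where "v = kernel_variation m Z \<Phi> (chain_scale N H)"
  fix \<epsilon> :: real assume "0 < \<epsilon>"
  interpret Z: prob_space Z using K by (simp add: density_kernel_def)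
  have \<Phi>: "\<Phi> z \<in> prob_densities m" if "z \<in> space Z" for z
    using K that by (simp add: density_kernel_def)
  obtain p :: "nat \<Rightarrow> 'a pmf" and c where pc: "\<And>i. 1 \<le> i \<Longrightarrow> i \<le> N \<Longrightarrow> finite (set_pmf (p i))"
    "\<And>i y. 1 \<le> i \<Longrightarrow> i \<le> N \<Longrightarrow> y \<in> set_pmf (p i) \<Longrightarrow> dist 0 (c i y) \<le> quotient_radius H i"
    "\<And>f \<phi>. 1-lipschitz_on UNIV f \<Longrightarrow> \<phi> \<in> prob_densities m \<Longrightarrow>
      \<bar>(\<integral>g. f g * \<phi> g \<partial>m) - (\<integral>g. f g \<partial>m)\<bar>
        \<le> (\<Sum>i=1..N. quotient_radius H i
            * mean (p i) (\<lambda>y. \<integral>g. \<bar>\<phi> (- c i y + g) - \<phi> g\<bar> \<partial>m)) + \<epsilon>"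
    using chain_transport[OF H \<open>0 < \<epsilon>\<close>] by blast
  define a where "a = (\<lambda>i y. ennreal (quotient_radius H i * pmf (p i) y))"
  define V where "V = (\<lambda>i y z. total_variation m (left_translate (c i y) (\<Phi> z)) (\<Phi> z))"
  have r0: "0 \<le> quotient_radius H i" if "i \<in> {1..N}" for i
    using quotient_radius_nonneg[OF H] that by simp
  have W: "wasserstein (density_measure m (\<Phi> z)) m
      \<le> (\<Sum>i=1..N. \<Sum>y\<in>set_pmf (p i). a i y * (2 * V i y z)) + ennreal \<epsilon>" if z: "z \<in> space Z" for z
    unfolding wasserstein_def
  proof (rule SUP_least)
    fix f :: "'a \<Rightarrow> real" assume "f \<in> {f. 1-lipschitz_on UNIV f}"
    then have f: "1-lipschitz_on UNIV f" by simp
    define D where "D = (\<lambda>i y. \<integral>g. \<bar>\<Phi> z (- c i y + g) - \<Phi> z g\<bar> \<partial>m)"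
    have D0: "0 \<le> D i y" for i y by (simp add: D_def)
    have "\<bar>(\<integral>x. f x \<partial>density_measure m (\<Phi> z)) - (\<integral>x. f x \<partial>m)\<bar>
        \<le> (\<Sum>i=1..N. \<Sum>y\<in>set_pmf (p i). quotient_radius H i * pmf (p i) y * D i y) + \<epsilon>"
      using pc(3)[OF f \<Phi>[OF z]]
      by (simp add: integral_density_measure[OF \<Phi>[OF z] f] D_def mean_def sum_distrib_left mult.assoc)
    then have "ennreal \<bar>(\<integral>x. f x \<partial>density_measure m (\<Phi> z)) - (\<integral>x. f x \<partial>m)\<bar>
        \<le> ennreal ((\<Sum>i=1..N. \<Sum>y\<in>set_pmf (p i). quotient_radius H i * pmf (p i) y * D i y) + \<epsilon>)"
      by (rule ennreal_leI)
    also have "\<dots> = ennreal (\<Sum>i=1..N. \<Sum>y\<in>set_pmf (p i). quotient_radius H i * pmf (p i) y * D i y)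
        + ennreal \<epsilon>"
      using r0 D0 \<open>0 < \<epsilon>\<close> by (intro ennreal_plus sum_nonneg) auto
    also have "ennreal (\<Sum>i=1..N. \<Sum>y\<in>set_pmf (p i). quotient_radius H i * pmf (p i) y * D i y)
        = (\<Sum>i=1..N. \<Sum>y\<in>set_pmf (p i). a i y * (2 * V i y z))"
    proof -
      have "ennreal (quotient_radius H i * pmf (p i) y * D i y) = a i y * (2 * V i y z)"
        if "i \<in> {1..N}" for i y
        using r0[OF that] D0[of i y] total_variation_eq_integral[OF \<Phi>[OF z], of "c i y"]
        by (simp add: a_def V_def D_def ennreal_mult)
      then show ?thesis
        using r0 D0 by (subst sum_ennreal[symmetric]) (auto intro!: sum_nonneg sum.cong
          simp: sum_ennreal[symmetric])
    qed
    finally show "ennreal \<bar>(\<integral>x. f x \<partial>density_measure m (\<Phi> z)) - (\<integral>x. f x \<partial>m)\<bar>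
      \<le> (\<Sum>i=1..N. \<Sum>y\<in>set_pmf (p i). a i y * (2 * V i y z)) + ennreal \<epsilon>" .
  qed
  have [measurable]: "V i y \<in> borel_measurable Z" for i y
    unfolding V_def by (rule measurable_total_variation[OF K])
  \<comment> \<open>Each \<open>c i y\<close> lies in the ball whose radius is the largest quotient
    radius, so it competes in the supremum over translations.\<close>
  have V_le: "(\<integral>\<^sup>+z. V i y z \<partial>Z) \<le> v" if "i \<in> {1..N}" "y \<in> set_pmf (p i)" for i y
  proof -
    have "dist 0 (c i y) \<le> quotient_radius H i" using pc(2) that by simp
    also have "\<dots> \<le> chain_scale N H"
      unfolding chain_scale_def using that by (intro Max_ge) auto
    finally show ?thesis
      unfolding v_def kernel_variation_def V_def by (intro SUP_upper) simp
  qed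
  have "kernel_wasserstein m Z \<Phi>
      \<le> (\<integral>\<^sup>+z. (\<Sum>i=1..N. \<Sum>y\<in>set_pmf (p i). a i y * (2 * V i y z)) + ennreal \<epsilon> \<partial>Z)"
    unfolding kernel_wasserstein_def by (rule nn_integral_mono) (rule W)
  also have "\<dots> = (\<Sum>i=1..N. \<Sum>y\<in>set_pmf (p i). a i y * (2 * (\<integral>\<^sup>+z. V i y z \<partial>Z))) + ennreal \<epsilon>"
    by (simp add: nn_integral_add nn_integral_sum nn_integral_cmult Z.emeasure_space_1)
  also have "(\<Sum>i=1..N. \<Sum>y\<in>set_pmf (p i). a i y * (2 * (\<integral>\<^sup>+z. V i y z \<partial>Z)))
      \<le> (\<Sum>i=1..N. \<Sum>y\<in>set_pmf (p i). a i y * (2 * v))"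
    using V_le by (intro sum_mono mult_left_mono) auto
  \<comment> \<open>The weights of level \<open>i\<close> add up to the \<open>i\<close>-th quotient
    radius, and these add up to the chain length.\<close>
  also have "\<dots> = (\<Sum>i=1..N. ennreal (quotient_radius H i) * (2 * v))"
  proof (rule sum.cong[OF refl])
    fix i assume i: "i \<in> {1..N}"
    have "(\<Sum>y\<in>set_pmf (p i). a i y) = ennreal (\<Sum>y\<in>set_pmf (p i). quotient_radius H i * pmf (p i) y)"
      using r0[OF i] by (simp add: a_def)
    also have "\<dots> = ennreal (quotient_radius H i)"
      using pc(1)[of i] i by (simp add: sum_distrib_left[symmetric] sum_pmf_eq_1)
    finally show "(\<Sum>y\<in>set_pmf (p i). a i y * (2 * v)) = ennreal (quotient_radius H i) * (2 * v)"
      by (simp add: sum_distrib_right[symmetric])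
  qed
  also have "\<dots> = ennreal (chain_length N H) * (2 * v)"
    unfolding chain_length_def sum_distrib_right[symmetric] using r0 by (subst sum_ennreal) auto
  also have "\<dots> = ennreal (2 * chain_length N H) * v"
  proof -
    have "0 \<le> chain_length N H" unfolding chain_length_def by (rule sum_nonneg) (rule r0)
    then show ?thesis by (simp add: ennreal_mult ac_simps)
  qed
  finally show "kernel_wasserstein m Z \<Phi> \<le> ennreal (2 * chain_length N H)
      * kernel_variation m Z \<Phi> (chain_scale N H) + ennreal \<epsilon>"
    by (simp add: v_def add_right_mono)
qed

end

theorem proposition3p3:
  fixes m :: "'a::{metric_space,topological_group_add} measure"
    and N :: nat and H :: "nat \<Rightarrow> 'a set"
  assumes "measure_metric_group m"
    and "martingale_chain N H"
  shows "(\<forall>(Z :: 'z measure) \<Phi>. density_kernel m Z \<Phi> \<longrightarrow>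
            kernel_wasserstein m Z \<Phi>
              \<le> ennreal (2 * chain_length N H) * kernel_variation m Z \<Phi> (chain_scale N H)) \<and>
         (\<forall>\<epsilon>>0. wasserstein_modulus TYPE('z) m (chain_scale N H) \<epsilon>
              \<le> ennreal (2 * chain_length N H * \<epsilon>))"
proof (intro conjI allI impI)
  interpret compact_haar_group m by standard (rule assms(1))
  show *: "kernel_wasserstein m Z \<Phi>
      \<le> ennreal (2 * chain_length N H) * kernel_variation m Z \<Phi> (chain_scale N H)"
    if "density_kernel m Z \<Phi>" for Z :: "'z measure" and \<Phi>
    by (rule kernel_wasserstein_le[OF assms(2) that])
  fix \<epsilon> :: real assume "0 < \<epsilon>"
  \<comment> \<open>Since \<open>ennreal\<close> truncates negative numbers to 0, splitting the
    product in the bound depends on this sign.\<close>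
  have "0 \<le> chain_length N H"
    unfolding chain_length_def using quotient_radius_nonneg[OF assms(2)] by (intro sum_nonneg) auto
  then have "kernel_wasserstein m Z \<Phi> \<le> ennreal (2 * chain_length N H * \<epsilon>)"
    if "density_kernel m Z \<Phi>" "kernel_variation m Z \<Phi> (chain_scale N H) \<le> ennreal \<epsilon>"
    for Z :: "'z measure" and \<Phi>
    using order.trans[OF *[OF that(1)] mult_left_mono[OF that(2)]] \<open>0 < \<epsilon>\<close>
    by (simp add: ennreal_mult)
  then show "wasserstein_modulus TYPE('z) m (chain_scale N H) \<epsilon> \<le> ennreal (2 * chain_length N H * \<epsilon>)"
    unfolding wasserstein_modulus_def by (intro SUP_least) auto
qed

end
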